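(* Let $E$ be a linear relation on $\mathcal{H}$. Then 1. $E$ is sub-idempotent if and only if $E^2 = P_{\ker(I-E),\, \ker E}\ \hat{+}\ (\{0\}\times\operatorname{mul} E)$. 2. $E$ is super-idempotent if and only if $E^2 = P_{\operatorname{ran} E,\, \operatorname{ran}(I-E)} \cap (\operatorname{dom} E\times\mathcal{H})$. In either case (that is, whenever $E$ is sub-idempotent or super-idempotent), $E^2$ is idempotent.
   Context: $\mathcal{H}$ is a complex separable Hilbert space; "subspace" means linear subspace, not necessarily closed. A linear relation on $\mathcal{H}$ is a linear subspace $E \subseteq \mathcal{H}\times\mathcal{H}$, with $\operatorname{dom}E=\{x:(x,y)\in E \text{ for some } y\}$, $\operatorname{ran}E=\{y:(x,y)\in E\text{ for some }x\}$, $\ker E=\{x:(x,0)\in E\}$, $\operatorname{mul}E=\{y:(0,y)\in E\}$. Product: $ST=\{(x,y): (x,z)\in T,\ (z,y)\in S \text{ for some } z\}$, and $E^2=EE$. $E$ is idempotent if $E^2=E$, sub-idempotent if $E^2\subseteq E$, super-idempotent if $E\subseteq E^2$. $I=\{(u,u):u\in\mathcal{H}\}$ and $I-E=\{(x,x-y):(x,y)\in E\}$. $T\,\hat{+}\,S$ denotes the sum of $T$ and $S$ as linear subspaces of $\mathcal{H}\times\mathcal{H}$. For subspaces $\mathcal{M},\mathcal{N}$ of $\mathcal{H}$, $P_{\mathcal{M},\mathcal{N}}:=\{(m+n,m): m\in\mathcal{M},\ n\in\mathcal{N}\}$. *)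

theory Defs
  imports "HOL-Analysis.Analysis"
begin

section \<open>Complex Hilbert spaces\<close>

class complex_vector = real_vector +
  fixes scaleC :: "complex \<Rightarrow> 'a \<Rightarrow> 'a"  (infixr "*\<^sub>C" 75)
  assumes scaleC_add_right: "c *\<^sub>C (x + y) = c *\<^sub>C x + c *\<^sub>C y"
    and scaleC_add_left: "(c + d) *\<^sub>C x = c *\<^sub>C x + d *\<^sub>C x"
    and scaleC_scaleC: "c *\<^sub>C (d *\<^sub>C x) = (c * d) *\<^sub>C x"
    and scaleC_one: "1 *\<^sub>C x = x"
    and scaleR_scaleC: "r *\<^sub>R x = complex_of_real r *\<^sub>C x"

interpretation complex_vector: vector_space "scaleC :: complex \<Rightarrow> 'a \<Rightarrow> 'a::complex_vector"
  by unfold_locales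
    (simp_all add: scaleC_add_right scaleC_add_left scaleC_scaleC scaleC_one)

text \<open>The inner product is linear in the first argument. The norm, metric and topology are
  the ones it induces, by \<open>norm_eq_sqrt_cinner\<close> and the axioms of normed spaces.\<close>

class complex_inner = complex_vector + real_normed_vector +
  fixes cinner :: "'a \<Rightarrow> 'a \<Rightarrow> complex"
  assumes cinner_commute: "cinner x y = cnj (cinner y x)"
    and cinner_add_left: "cinner (x + y) z = cinner x z + cinner y z"
    and cinner_scaleC_left: "cinner (c *\<^sub>C x) y = c * cinner x y"
    and cinner_ge_zero: "0 \<le> Re (cinner x x)"
    and cinner_eq_zero_iff: "cinner x x = 0 \<longleftrightarrow> x = 0"
    and norm_eq_sqrt_cinner: "norm x = sqrt (Re (cinner x x))"

class chilbert_space = complex_inner + complete_space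

text \<open>The axioms are satisfiable: the complex numbers form such a space.\<close>

instantiation complex :: chilbert_space
begin

definition scaleC_complex :: "complex \<Rightarrow> complex \<Rightarrow> complex"
  where "scaleC_complex c x = c * x"

definition cinner_complex :: "complex \<Rightarrow> complex \<Rightarrow> complex"
  where "cinner_complex x y = x * cnj y"

instance
proof
  fix x :: complex
  show "norm x = sqrt (Re (cinner x x))"
    by (simp add: cinner_complex_def cmod_def power2_eq_square)
qed (auto simp: scaleC_complex_def cinner_complex_def scaleR_conv_of_real distrib_left
    distrib_right mult.assoc mult.commute)

end


section \<open>Linear relations\<close>

instantiation prod :: (complex_vector, complex_vector) complex_vector
begin

definition scaleC_prod :: "complex \<Rightarrow> 'a \<times> 'b \<Rightarrow> 'a \<times> 'b"
  where "scaleC_prod c p = (c *\<^sub>C fst p, c *\<^sub>C snd p)"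

instance
  by standard
    (auto simp: scaleC_prod_def scaleC_add_right scaleC_add_left scaleC_scaleC scaleC_one
      scaleR_prod_def scaleR_scaleC)

end

definition linear_relation :: "('a::complex_vector \<times> 'a) set \<Rightarrow> bool"
  where "linear_relation E \<longleftrightarrow> complex_vector.subspace E"

definition ker :: "('a::complex_vector \<times> 'a) set \<Rightarrow> 'a set"
  where "ker E = {x. (x, 0) \<in> E}"

definition mul :: "('a::complex_vector \<times> 'a) set \<Rightarrow> 'a set"
  where "mul E = {y. (0, y) \<in> E}"

text \<open>The product \<open>S T\<close> applies \<open>T\<close> first, whereas \<^term>\<open>T O S\<close> lists the relation
  applied first on the left.\<close>

definition rel_prod :: "('a \<times> 'a) set \<Rightarrow> ('a \<times> 'a) set \<Rightarrow> ('a \<times> 'a) set"  (infixl "\<odot>" 75)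
  where "S \<odot> T = T O S"

definition rel_square :: "('a \<times> 'a) set \<Rightarrow> ('a \<times> 'a) set"
  where "rel_square E = E \<odot> E"

definition idempotent :: "('a \<times> 'a) set \<Rightarrow> bool"
  where "idempotent E \<longleftrightarrow> rel_square E = E"

definition sub_idempotent :: "('a \<times> 'a) set \<Rightarrow> bool"
  where "sub_idempotent E \<longleftrightarrow> rel_square E \<subseteq> E"

definition super_idempotent :: "('a \<times> 'a) set \<Rightarrow> bool"
  where "super_idempotent E \<longleftrightarrow> E \<subseteq> rel_square E"

definition id_minus :: "('a::complex_vector \<times> 'a) set \<Rightarrow> ('a \<times> 'a) set"
  where "id_minus E = {(x, x - y) | x y. (x, y) \<in> E}"

definition rel_sum :: "('a::complex_vector \<times> 'a) set \<Rightarrow> ('a \<times> 'a) set \<Rightarrow> ('a \<times> 'a) set"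
    (infixl "\<oplus>\<^sub>r" 65)
  where "T \<oplus>\<^sub>r S = {t + s | t s. t \<in> T \<and> s \<in> S}"

definition proj_rel :: "'a::complex_vector set \<Rightarrow> 'a set \<Rightarrow> ('a \<times> 'a) set"
  where "proj_rel M N = {(m + n, m) | m n. m \<in> M \<and> n \<in> N}"

end

theory Submission
  imports Defs
begin

text \<open>Every element of the first right-hand side splits as \<open>(m, m) + (n, 0) + (0, k)\<close> with all
  three summands in \<open>E\<close>, so it lies in both \<open>E\<close> and its square; dually, \<open>E\<close> and its square are
  always contained in the second right-hand side. Hence only one inclusion of each
  equivalence is not formal. If \<open>(x, y)\<close>, \<open>(y, z)\<close> and \<open>(x, z)\<close> all belong to \<open>E\<close>, then
  \<open>y - z\<close> is in the multivalued part, \<open>(y, y)\<close> is in \<open>E\<close> and \<open>x - y\<close> is in the kernel: this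
  splits \<open>(x, z)\<close> when \<open>E\<close> is sub-idempotent and all of \<open>E\<close> when \<open>E\<close> is super-idempotent.\<close>

lemma mem_rel_square_iff: "(x, z) \<in> rel_square E \<longleftrightarrow> (\<exists>y. (x, y) \<in> E \<and> (y, z) \<in> E)"
  by (auto simp: rel_square_def rel_prod_def)

lemma rel_square_mono: "E \<subseteq> F \<Longrightarrow> rel_square E \<subseteq> rel_square F"
  by (auto simp: rel_square_def rel_prod_def)

text \<open>\<open>m\<close> is the component in \<open>ker (id_minus E)\<close>, that is, a point
  with \<open>(m, m)\<close> in \<open>E\<close>; once it is chosen, the other two components are
  forced to be \<open>x - m\<close> and \<open>y - m\<close>.\<close>

lemma mem_proj_ker_sum_mul_iff:
  "(x, y) \<in> proj_rel (ker (id_minus E)) (ker E) \<oplus>\<^sub>r ({0} \<times> mul E) \<longleftrightarrow>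
     (\<exists>m. (m, m) \<in> E \<and> (x - m, 0) \<in> E \<and> (0, y - m) \<in> E)" (is "?L \<longleftrightarrow> ?R")
proof
  assume ?L
  then show ?R
    by (auto simp: rel_sum_def proj_rel_def ker_def id_minus_def mul_def)
next
  assume ?R
  then obtain m where m: "(m, m) \<in> E" "(x - m, 0) \<in> E" "(0, y - m) \<in> E"
    by blast
  have "(x, m) \<in> proj_rel (ker (id_minus E)) (ker E)"
    unfolding proj_rel_def ker_def id_minus_def
    by (rule CollectI, rule exI[of _ m], rule exI[of _ "x - m"]) (use m in auto)
  moreover have "(0, y - m) \<in> {0} \<times> mul E"
    using m by (simp add: mul_def)
  ultimately show ?L
    unfolding rel_sum_def
    by (intro CollectI exI[of _ "(x, m)"] exI[of _ "(0, y - m)"]) auto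
qed

text \<open>The range component must be \<open>y\<close>, so the other one is \<open>x - y\<close>.
  In this form \<open>x\<close> and \<open>y\<close> are tied together only through their
  difference.\<close>

lemma mem_proj_ran_inter_dom_iff:
  "(x, y) \<in> proj_rel (Range E) (Range (id_minus E)) \<inter> (Domain E \<times> UNIV) \<longleftrightarrow>
     x \<in> Domain E \<and> y \<in> Range E \<and> (\<exists>u v. (u, v) \<in> E \<and> x - y = u - v)" (is "?L \<longleftrightarrow> ?R")
proof
  assume ?L
  then show ?R
    by (force simp: proj_rel_def id_minus_def)
next
  assume ?R
  then have "x - y \<in> Range (id_minus E)"
    by (force simp: id_minus_def)
  then have "(x, y) \<in> proj_rel (Range E) (Range (id_minus E))"
    using \<open>?R\<close> unfolding proj_rel_def
    by (intro CollectI exI[of _ y] exI[of _ "x - y"]) simp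
  then show ?L
    using \<open>?R\<close> by blast
qed

lemma linear_relation_add:
  "linear_relation E \<Longrightarrow> (a, b) \<in> E \<Longrightarrow> (c, d) \<in> E \<Longrightarrow> (a + c, b + d) \<in> E"
  using complex_vector.subspace_add[of E "(a, b)" "(c, d)"] by (simp add: linear_relation_def)

lemma linear_relation_diff:
  "linear_relation E \<Longrightarrow> (a, b) \<in> E \<Longrightarrow> (c, d) \<in> E \<Longrightarrow> (a - c, b - d) \<in> E"
  using complex_vector.subspace_diff[of E "(a, b)" "(c, d)"] by (simp add: linear_relation_def)

text \<open>The middle point \<open>y\<close> of the chain is the witness \<open>m\<close>.\<close>

lemma mem_proj_ker_sum_mulI:
  assumes E: "linear_relation E" and "(x, y) \<in> E" "(y, z) \<in> E" "(x, z) \<in> E"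
  shows "(x, z) \<in> proj_rel (ker (id_minus E)) (ker E) \<oplus>\<^sub>r ({0} \<times> mul E)"
proof -
  have zy: "(0, z - y) \<in> E"
    using linear_relation_diff[OF E assms(4) assms(2)] by simp
  have yy: "(y, y) \<in> E"
    using linear_relation_diff[OF E assms(3) zy] by simp
  have "(x - y, 0) \<in> E"
    using linear_relation_diff[OF E assms(2) yy] by simp
  with yy zy show ?thesis
    unfolding mem_proj_ker_sum_mul_iff by blast
qed

text \<open>The point \<open>m\<close> is the intermediate one for the square: adding
  \<open>(m, m)\<close> to the kernel part gives \<open>(x, m)\<close>, and adding it to the
  multivalued part gives \<open>(m, y)\<close>.\<close>

lemma proj_ker_sum_mul_subset:
  assumes E: "linear_relation E"
  shows "proj_rel (ker (id_minus E)) (ker E) \<oplus>\<^sub>r ({0} \<times> mul E) \<subseteq> E \<inter> rel_square E"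
proof (rule subrelI)
  fix x y assume "(x, y) \<in> proj_rel (ker (id_minus E)) (ker E) \<oplus>\<^sub>r ({0} \<times> mul E)"
  then obtain m where m: "(m, m) \<in> E" "(x - m, 0) \<in> E" "(0, y - m) \<in> E"
    unfolding mem_proj_ker_sum_mul_iff by blast
  have xm: "(x, m) \<in> E" and my: "(m, y) \<in> E"
    using linear_relation_add[OF E m(2) m(1)] linear_relation_add[OF E m(3) m(1)] by simp_all
  moreover have "(x, y) \<in> E"
    using linear_relation_add[OF E xm m(3)] by simp
  ultimately show "(x, y) \<in> E \<inter> rel_square E"
    by (auto simp: mem_rel_square_iff)
qed

lemma subset_proj_ran_inter_dom:
  "E \<subseteq> proj_rel (Range E) (Range (id_minus E)) \<inter> (Domain E \<times> UNIV)"
proof (rule subrelI)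
  fix x y assume "(x, y) \<in> E"
  then show "(x, y) \<in> proj_rel (Range E) (Range (id_minus E)) \<inter> (Domain E \<times> UNIV)"
    unfolding mem_proj_ran_inter_dom_iff by blast
qed

text \<open>Differences telescope, and those of the form \<open>u - v\<close> with
  \<open>(u, v)\<close> in \<open>E\<close> are closed under addition. Transitivity both bounds the
  square of \<open>E\<close> and later yields idempotence in the super-idempotent case.\<close>

lemma proj_ran_inter_dom_trans:
  assumes E: "linear_relation E"
  defines "Q \<equiv> proj_rel (Range E) (Range (id_minus E)) \<inter> (Domain E \<times> UNIV)"
  assumes "(x, y) \<in> Q" "(y, z) \<in> Q"
  shows "(x, z) \<in> Q"
proof -
  obtain u v u' v' where uv: "(u, v) \<in> E" "x - y = u - v" and uv': "(u', v') \<in> E" "y - z = u' - v'"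
    using assms(3,4) unfolding Q_def mem_proj_ran_inter_dom_iff by blast
  have "x - z = (x - y) + (y - z)"
    by simp
  also have "\<dots> = (u + u') - (v + v')"
    unfolding uv uv' by (simp add: algebra_simps)
  finally show ?thesis
    using assms(3,4) linear_relation_add[OF E uv(1) uv'(1)]
    unfolding Q_def mem_proj_ran_inter_dom_iff by blast
qed

lemma rel_square_subset_proj_ran_inter_dom:
  assumes "linear_relation E"
  shows "rel_square E \<subseteq> proj_rel (Range E) (Range (id_minus E)) \<inter> (Domain E \<times> UNIV)"
proof (rule subrelI)
  fix x z assume "(x, z) \<in> rel_square E"
  then obtain y where "(x, y) \<in> E" "(y, z) \<in> E"
    unfolding mem_rel_square_iff by blast
  then show "(x, z) \<in> proj_rel (Range E) (Range (id_minus E)) \<inter> (Domain E \<times> UNIV)"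
    by (intro proj_ran_inter_dom_trans[OF assms, of x y z] subsetD[OF subset_proj_ran_inter_dom])
qed

lemma sub_idempotent_rel_square:
  assumes "linear_relation E" "sub_idempotent E"
  shows "rel_square E = proj_rel (ker (id_minus E)) (ker E) \<oplus>\<^sub>r ({0} \<times> mul E)"
proof (rule antisym[OF subrelI])
  fix x z assume xz: "(x, z) \<in> rel_square E"
  moreover have "(x, z) \<in> E"
    using xz assms(2) by (auto simp: sub_idempotent_def)
  ultimately show "(x, z) \<in> proj_rel (ker (id_minus E)) (ker E) \<oplus>\<^sub>r ({0} \<times> mul E)"
    using mem_proj_ker_sum_mulI[OF assms(1)] unfolding mem_rel_square_iff by blast
qed (use proj_ker_sum_mul_subset[OF assms(1)] in blast)

text \<open>Super-idempotence puts a middle point on every pair of \<open>E\<close>, and that point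
  serves as \<open>m\<close>.\<close>

lemma super_idempotent_decomp:
  assumes "linear_relation E" "super_idempotent E" "(x, y) \<in> E"
  obtains m where "(m, m) \<in> E" "(x - m, 0) \<in> E" "(0, y - m) \<in> E"
proof -
  obtain w where "(x, w) \<in> E" "(w, y) \<in> E"
    using subsetD[OF assms(2)[unfolded super_idempotent_def] assms(3)]
    unfolding mem_rel_square_iff by blast
  then show ?thesis
    using mem_proj_ker_sum_mulI[OF assms(1) _ _ assms(3)] that
    unfolding mem_proj_ker_sum_mul_iff by blast
qed

text \<open>Membership in the right-hand side provides three pairs of \<open>E\<close> linked only
  by \<open>x - y = u - v\<close>. Each is split, and this equation glues the pieces into a chain
  from \<open>x\<close> to \<open>y\<close>.\<close>

lemma super_idempotent_rel_square:
  assumes E: "linear_relation E" and super: "super_idempotent E"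
  shows "rel_square E = proj_rel (Range E) (Range (id_minus E)) \<inter> (Domain E \<times> UNIV)"
proof (rule antisym[OF rel_square_subset_proj_ran_inter_dom[OF E] subrelI])
  fix x y assume "(x, y) \<in> proj_rel (Range E) (Range (id_minus E)) \<inter> (Domain E \<times> UNIV)"
  then obtain w a u v where "(x, w) \<in> E" "(a, y) \<in> E" "(u, v) \<in> E" and xy: "x - y = u - v"
    unfolding mem_proj_ran_inter_dom_iff by blast
  obtain p where p: "(p, p) \<in> E" "(x - p, 0) \<in> E"
    using super_idempotent_decomp[OF E super \<open>(x, w) \<in> E\<close>] by blast
  obtain s where s: "(s, s) \<in> E" "(0, y - s) \<in> E"
    using super_idempotent_decomp[OF E super \<open>(a, y) \<in> E\<close>] by blast
  obtain t where t: "(u - t, 0) \<in> E" "(0, v - t) \<in> E"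
    using super_idempotent_decomp[OF E super \<open>(u, v) \<in> E\<close>] by blast
  \<comment> \<open>The relation \<open>x - y = u - v\<close> says that \<open>p - s\<close> is the sum of \<open>(y - s) - (v - t)\<close> in \<open>mul E\<close>
    and \<open>(u - t) - (x - p)\<close> in \<open>ker E\<close>; the intermediate point is \<open>p\<close> moved along \<open>mul E\<close> or,
    equally, \<open>s\<close> moved along \<open>ker E\<close>.\<close>
  define q where "q = p - ((y - s) - (v - t))"
  have "x = y + u - v"
    using xy by (simp add: algebra_simps)
  then have q_eq: "q = s - ((x - p) - (u - t))"
    by (simp add: q_def algebra_simps)
  have "(x, p) \<in> E"
    using linear_relation_add[OF E p(2) p(1)] by simp
  from linear_relation_diff[OF E this linear_relation_diff[OF E s(2) t(2)]]
  have "(x, q) \<in> E"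
    by (simp add: q_def)
  moreover have "(s, y) \<in> E"
    using linear_relation_add[OF E s(2) s(1)] by simp
  from linear_relation_diff[OF E this linear_relation_diff[OF E p(2) t(1)]]
  have "(q, y) \<in> E"
    by (simp add: q_eq)
  ultimately show "(x, y) \<in> rel_square E"
    unfolding mem_rel_square_iff by blast
qed

lemma sub_idempotent_imp_idempotent_rel_square:
  assumes E: "linear_relation E" and sub: "sub_idempotent E"
  shows "idempotent (rel_square E)"
  unfolding idempotent_def
proof (rule antisym[OF rel_square_mono subrelI])
  show "rel_square E \<subseteq> E"
    using sub by (simp add: sub_idempotent_def)
next
  fix x y assume "(x, y) \<in> rel_square E"
  then obtain m where m: "(m, m) \<in> E" "(x - m, 0) \<in> E" "(0, y - m) \<in> E"
    unfolding sub_idempotent_rel_square[OF E sub] mem_proj_ker_sum_mul_iff by blast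
  have "(x, m) \<in> E" "(m, y) \<in> E"
    using linear_relation_add[OF E m(2) m(1)] linear_relation_add[OF E m(3) m(1)] by simp_all
  \<comment> \<open>Inserting the loop \<open>(m, m)\<close> after \<open>(x, m)\<close> and before
    \<open>(m, y)\<close> puts both pairs in the square of \<open>E\<close>.\<close>
  with m(1) show "(x, y) \<in> rel_square (rel_square E)"
    unfolding mem_rel_square_iff by blast
qed

text \<open>The square equals a transitive relation, which gives one inclusion; the other is
  monotonicity applied to \<open>E \<subseteq> rel_square E\<close>.\<close>

lemma super_idempotent_imp_idempotent_rel_square:
  assumes E: "linear_relation E" and super: "super_idempotent E"
  shows "idempotent (rel_square E)"
  unfolding idempotent_def
proof (rule antisym[OF subrelI rel_square_mono])
  fix x z assume "(x, z) \<in> rel_square (rel_square E)"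
  then obtain y where "(x, y) \<in> rel_square E" "(y, z) \<in> rel_square E"
    unfolding mem_rel_square_iff[of x z "rel_square E"] by blast
  then show "(x, z) \<in> rel_square E"
    unfolding super_idempotent_rel_square[OF E super] by (rule proj_ran_inter_dom_trans[OF E])
next
  show "E \<subseteq> rel_square E"
    using super by (simp add: super_idempotent_def)
qed

theorem theorem3p18:
  fixes E :: "('a::chilbert_space \<times> 'a) set"
  assumes "separable_space (euclidean :: 'a topology)"
    and "linear_relation E"
  shows "(sub_idempotent E \<longleftrightarrow>
            rel_square E = proj_rel (ker (id_minus E)) (ker E) \<oplus>\<^sub>r ({0} \<times> mul E)) \<and>
         (super_idempotent E \<longleftrightarrow>
            rel_square E =
              proj_rel (Range E) (Range (id_minus E)) \<inter> (Domain E \<times> (UNIV :: 'a set))) \<and>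
         (sub_idempotent E \<or> super_idempotent E \<longrightarrow> idempotent (rel_square E))"
proof (intro conjI iffI impI)
  let ?P = "proj_rel (ker (id_minus E)) (ker E) \<oplus>\<^sub>r ({0} \<times> mul E)"
  let ?Q = "proj_rel (Range E) (Range (id_minus E)) \<inter> (Domain E \<times> (UNIV :: 'a set))"
  show "sub_idempotent E \<Longrightarrow> rel_square E = ?P"
    by (rule sub_idempotent_rel_square[OF assms(2)])
  show "rel_square E = ?P \<Longrightarrow> sub_idempotent E"
    using proj_ker_sum_mul_subset[OF assms(2)] unfolding sub_idempotent_def by simp
  show "super_idempotent E \<Longrightarrow> rel_square E = ?Q"
    by (rule super_idempotent_rel_square[OF assms(2)])
  show "rel_square E = ?Q \<Longrightarrow> super_idempotent E"
    using subset_proj_ran_inter_dom[of E] unfolding super_idempotent_def by simp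
  show "sub_idempotent E \<or> super_idempotent E \<Longrightarrow> idempotent (rel_square E)"
    using sub_idempotent_imp_idempotent_rel_square[OF assms(2)]
      super_idempotent_imp_idempotent_rel_square[OF assms(2)] by blast
qed

end
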